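(* Let $\mathcal{Q}$ be a quantaloid and let $F:\mathcal{C}\to\mathcal{D}$ be a dense (resp. codense) $\mathcal{Q}$-functor. If $L,L':\mathcal{D}\to\mathcal{E}$ are left adjoint $\mathcal{Q}$-functors (resp. $R,R':\mathcal{D}\to\mathcal{E}$ are right adjoint $\mathcal{Q}$-functors) satisfying $$LF\cong L'F\quad(\text{resp. } RF\cong R'F),$$ then $L\cong L'$ (resp. $R\cong R'$). In particular, if $\mathcal{D}$ has a co-Sierpiński (resp. Sierpiński) object $X$ and $LX\cong L'X$ (resp. $RX\cong R'X$), then $L\cong L'$ (resp. $R\cong R'$).
   Context: Quantaloids. A quantaloid $\mathcal{Q}$ is a (possibly large) 2-category whose 2-cells are given by order, such that each hom-set $\mathcal{Q}(S,T)$ is a complete lattice and composition preserves joins in each variable. Left and right implications are defined by $v\circ u\le w\iff v\le w\swarrow u\iff u\le v\searrow w$ for $u:S\to T$, $v:T\to U$, $w:S\to U$. Write $\mathcal{Q}_0=\mathrm{ob}\,\mathcal{Q}$. $\mathcal{Q}$-categories. A $\mathcal{Q}$-category $\mathcal{E}$ has a class $\mathcal{E}_0$ of objects, an extent function $|\text{-}|:\mathcal{E}_0\to\mathcal{Q}_0$, and $\mathcal{E}(X,Y)\in\mathcal{Q}(|X|,|Y|)$ with $1_{|X|}\le\mathcal{E}(X,X)$ and $\mathcal{E}(Y,Z)\circ\mathcal{E}(X,Y)\le\mathcal{E}(X,Z)$. Its underlying preorder is: $X\le Y$ iff $|X|=|Y|$ and $1_{|X|}\le\mathcal{E}(X,Y)$;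 $X\cong Y$ means $X\le Y$ and $Y\le X$. A $\mathcal{Q}$-functor $F:\mathcal{D}\to\mathcal{E}$ is a function $F:\mathcal{D}_0\to\mathcal{E}_0$ with $|FX|=|X|$ and $\mathcal{D}(X,Y)\le\mathcal{E}(FX,FY)$. $\mathcal{Q}$-functors are ordered pointwise, and $F\cong G$ means $FX\cong GX$ for all $X$. Adjunctions. $\mathcal{Q}$-functors $L:\mathcal{D}\to\mathcal{E}$, $R:\mathcal{E}\to\mathcal{D}$ form an adjunction $L\dashv R$ ($L$ left adjoint, $R$ right adjoint) if $1_{\mathcal{D}}\le RL$ and $LR\le 1_{\mathcal{E}}$, equivalently $\mathcal{E}(LX,Y)=\mathcal{D}(X,RY)$ for all $X\in\mathcal{D}_0,Y\in\mathcal{E}_0$. A left (resp. right) adjoint $\mathcal{Q}$-functor is one that is the left (resp. right) adjoint of some $\mathcal{Q}$-functor. (Co)density. A sink $\sigma$ (resp. source $\tau$) of extent $T\in\mathcal{Q}_0$ on a $\mathcal{Q}$-category $\mathcal{D}$ is a family of $\mathcal{Q}$-arrows $\sigma(X):|X|\to T$ (resp. $\tau(X):T\to|X|$), $X\in\mathcal{D}_0$. For a $\mathcal{Q}$-functor $F:\mathcal{D}\to\mathcal{E}$, an object $C\in\mathcal{E}_0$ of extent $T$ is the colimit $\mathrm{colim}_\sigma F$ (resp. limit $\lim_\tau F$) if for all $Y\in\mathcal{E}_0$, $\mathcal{E}(C,Y)=\bigwedge_{X\in\mathcal{D}_0}\mathcal{E}(FX,Y)\swarrow\sigma(X)$ (resp.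 $\mathcal{E}(Y,C)=\bigwedge_{X\in\mathcal{D}_0}\tau(X)\searrow\mathcal{E}(Y,FX)$). $F$ is dense (resp. codense) if every object of $\mathcal{E}$ is the colimit (resp. limit) of $F$ weighted by some sink (resp. source) on $\mathcal{D}$. An object $X$ of a $\mathcal{Q}$-category is Sierpiński (resp. co-Sierpiński) if the inclusion of its one-object full $\mathcal{Q}$-subcategory $\{X\}$ is codense (resp. dense). *)

theory Defs
  imports "HOL-Algebra.Complete_Lattice"
begin

text \<open>
  Arrows of all hom-lattices live in one type; the hom-lattices of different pairs of objects
  need not be disjoint, so composition carries the three objects involved:
  \<open>Comp Q S T U v u\<close> is \<open>v \<circ> u : S \<rightarrow> U\<close> for \<open>u : S \<rightarrow> T\<close> and \<open>v : T \<rightarrow> U\<close>.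
\<close>

record ('o, 'a) quantaloid =
  Ob :: "'o set"
  Hom :: "'o \<Rightarrow> 'o \<Rightarrow> 'a gorder"
  Id :: "'o \<Rightarrow> 'a"
  Comp :: "'o \<Rightarrow> 'o \<Rightarrow> 'o \<Rightarrow> 'a \<Rightarrow> 'a \<Rightarrow> 'a"

abbreviation Arr :: "('o, 'a) quantaloid \<Rightarrow> 'o \<Rightarrow> 'o \<Rightarrow> 'a set" where
  "Arr Q S T \<equiv> carrier (Hom Q S T)"

locale quantaloid =
  fixes Q :: "('o, 'a) quantaloid"
  assumes hom_complete_lattice:
      "\<lbrakk>S \<in> Ob Q; T \<in> Ob Q\<rbrakk> \<Longrightarrow> complete_lattice (Hom Q S T)"
    and Id_closed: "S \<in> Ob Q \<Longrightarrow> Id Q S \<in> Arr Q S S"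
    and Comp_closed:
      "\<lbrakk>S \<in> Ob Q; T \<in> Ob Q; U \<in> Ob Q; u \<in> Arr Q S T; v \<in> Arr Q T U\<rbrakk>
        \<Longrightarrow> Comp Q S T U v u \<in> Arr Q S U"
    and Comp_assoc:
      "\<lbrakk>S \<in> Ob Q; T \<in> Ob Q; U \<in> Ob Q; V \<in> Ob Q;
        u \<in> Arr Q S T; v \<in> Arr Q T U; w \<in> Arr Q U V\<rbrakk>
        \<Longrightarrow> Comp Q S T V (Comp Q T U V w v) u = Comp Q S U V w (Comp Q S T U v u)"
    and Comp_Id_right:
      "\<lbrakk>S \<in> Ob Q; T \<in> Ob Q; u \<in> Arr Q S T\<rbrakk> \<Longrightarrow> Comp Q S S T u (Id Q S) = u"
    and Comp_Id_left:
      "\<lbrakk>S \<in> Ob Q; T \<in> Ob Q; u \<in> Arr Q S T\<rbrakk> \<Longrightarrow> Comp Q S T T (Id Q T) u = u"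
    and Comp_Sup_left:
      "\<lbrakk>S \<in> Ob Q; T \<in> Ob Q; U \<in> Ob Q; u \<in> Arr Q S T; A \<subseteq> Arr Q T U\<rbrakk>
        \<Longrightarrow> Comp Q S T U (\<Squnion>\<^bsub>Hom Q T U\<^esub> A) u = \<Squnion>\<^bsub>Hom Q S U\<^esub> ((\<lambda>v. Comp Q S T U v u) ` A)"
    and Comp_Sup_right:
      "\<lbrakk>S \<in> Ob Q; T \<in> Ob Q; U \<in> Ob Q; A \<subseteq> Arr Q S T; v \<in> Arr Q T U\<rbrakk>
        \<Longrightarrow> Comp Q S T U v (\<Squnion>\<^bsub>Hom Q S T\<^esub> A) = \<Squnion>\<^bsub>Hom Q S U\<^esub> ((\<lambda>u. Comp Q S T U v u) ` A)"

text \<open>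
  For \<open>u : S \<rightarrow> T\<close>, \<open>v : T \<rightarrow> U\<close>, \<open>w : S \<rightarrow> U\<close>: \<open>limp Q S T U w u\<close> is \<open>w \<swarrow> u : T \<rightarrow> U\<close> and
  \<open>rimp Q S T U v w\<close> is \<open>v \<searrow> w : S \<rightarrow> T\<close>. Existence and uniqueness of the elements described
  here are part of the lemmas \<open>limp_iff\<close> and \<open>rimp_iff\<close> below.
\<close>

definition limp :: "('o, 'a) quantaloid \<Rightarrow> 'o \<Rightarrow> 'o \<Rightarrow> 'o \<Rightarrow> 'a \<Rightarrow> 'a \<Rightarrow> 'a" where
  "limp Q S T U w u = (THE x. x \<in> Arr Q T U \<and>
     (\<forall>v\<in>Arr Q T U. Comp Q S T U v u \<sqsubseteq>\<^bsub>Hom Q S U\<^esub> w \<longleftrightarrow> v \<sqsubseteq>\<^bsub>Hom Q T U\<^esub> x))"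

definition rimp :: "('o, 'a) quantaloid \<Rightarrow> 'o \<Rightarrow> 'o \<Rightarrow> 'o \<Rightarrow> 'a \<Rightarrow> 'a \<Rightarrow> 'a" where
  "rimp Q S T U v w = (THE x. x \<in> Arr Q S T \<and>
     (\<forall>u\<in>Arr Q S T. Comp Q S T U v u \<sqsubseteq>\<^bsub>Hom Q S U\<^esub> w \<longleftrightarrow> u \<sqsubseteq>\<^bsub>Hom Q S T\<^esub> x))"

lemma residual_ex1:
  assumes L: "complete_lattice L" and M: "complete_lattice M"
    and f: "\<And>x. x \<in> carrier L \<Longrightarrow> f x \<in> carrier M"
    and f_Sup: "\<And>A. A \<subseteq> carrier L \<Longrightarrow> f (\<Squnion>\<^bsub>L\<^esub> A) = \<Squnion>\<^bsub>M\<^esub> (f ` A)"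
    and w: "w \<in> carrier M"
  shows "\<exists>!x. x \<in> carrier L \<and> (\<forall>v\<in>carrier L. f v \<sqsubseteq>\<^bsub>M\<^esub> w \<longleftrightarrow> v \<sqsubseteq>\<^bsub>L\<^esub> x)"
proof -
  interpret L: complete_lattice L by (rule L)
  interpret M: complete_lattice M by (rule M)
  define A where "A = {v \<in> carrier L. f v \<sqsubseteq>\<^bsub>M\<^esub> w}"
  define x where "x = \<Squnion>\<^bsub>L\<^esub> A"
  have A: "A \<subseteq> carrier L" by (auto simp: A_def)
  then have x: "x \<in> carrier L" by (simp add: x_def)
  have fA: "f ` A \<subseteq> carrier M" using A f by auto
  have fx: "f x \<sqsubseteq>\<^bsub>M\<^esub> w"
    unfolding x_def f_Sup[OF A] by (rule M.sup_least[OF fA w]) (auto simp: A_def)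
  have mono: "f v \<sqsubseteq>\<^bsub>M\<^esub> f x" if v: "v \<in> carrier L" and le: "v \<sqsubseteq>\<^bsub>L\<^esub> x" for v
  proof -
    have vx: "{v, x} \<subseteq> carrier L" using v x by simp
    have "\<Squnion>\<^bsub>L\<^esub> {v, x} = x"
    proof (rule L.le_antisym)
      show "\<Squnion>\<^bsub>L\<^esub> {v, x} \<sqsubseteq>\<^bsub>L\<^esub> x" by (rule L.sup_least[OF vx x]) (use le x in auto)
      show "x \<sqsubseteq>\<^bsub>L\<^esub> \<Squnion>\<^bsub>L\<^esub> {v, x}" by (rule L.sup_upper[OF vx]) simp
    qed (use vx x in \<open>auto intro: L.sup_closed\<close>)
    then have "f x = \<Squnion>\<^bsub>M\<^esub> (f ` {v, x})" using f_Sup[OF vx] by simp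
    moreover have "f v \<sqsubseteq>\<^bsub>M\<^esub> \<Squnion>\<^bsub>M\<^esub> (f ` {v, x})"
      by (rule M.sup_upper) (use f v x in auto)
    ultimately show ?thesis by simp
  qed
  have iff: "f v \<sqsubseteq>\<^bsub>M\<^esub> w \<longleftrightarrow> v \<sqsubseteq>\<^bsub>L\<^esub> x" if v: "v \<in> carrier L" for v
  proof
    assume "f v \<sqsubseteq>\<^bsub>M\<^esub> w"
    then show "v \<sqsubseteq>\<^bsub>L\<^esub> x" unfolding x_def by (intro L.sup_upper[OF A]) (simp add: A_def v)
  next
    assume "v \<sqsubseteq>\<^bsub>L\<^esub> x"
    from M.le_trans[OF mono[OF v this] fx f[OF v] f[OF x] w] show "f v \<sqsubseteq>\<^bsub>M\<^esub> w" .
  qed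
  show ?thesis
  proof (rule ex1I[of _ x])
    show "x \<in> carrier L \<and> (\<forall>v\<in>carrier L. f v \<sqsubseteq>\<^bsub>M\<^esub> w \<longleftrightarrow> v \<sqsubseteq>\<^bsub>L\<^esub> x)" using x iff by blast
    fix y assume y: "y \<in> carrier L \<and> (\<forall>v\<in>carrier L. f v \<sqsubseteq>\<^bsub>M\<^esub> w \<longleftrightarrow> v \<sqsubseteq>\<^bsub>L\<^esub> y)"
    then show "y = x" using x iff by (meson L.le_antisym L.le_refl)
  qed
qed

context quantaloid
begin

lemma limp_iff:
  assumes "S \<in> Ob Q" "T \<in> Ob Q" "U \<in> Ob Q" "u \<in> Arr Q S T" "w \<in> Arr Q S U"
  shows "limp Q S T U w u \<in> Arr Q T U \<and> (\<forall>v\<in>Arr Q T U.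
    Comp Q S T U v u \<sqsubseteq>\<^bsub>Hom Q S U\<^esub> w \<longleftrightarrow> v \<sqsubseteq>\<^bsub>Hom Q T U\<^esub> limp Q S T U w u)"
  unfolding limp_def
  by (rule theI', rule residual_ex1)
    (use assms in \<open>auto intro: hom_complete_lattice Comp_closed Comp_Sup_left\<close>)

lemma rimp_iff:
  assumes "S \<in> Ob Q" "T \<in> Ob Q" "U \<in> Ob Q" "v \<in> Arr Q T U" "w \<in> Arr Q S U"
  shows "rimp Q S T U v w \<in> Arr Q S T \<and> (\<forall>u\<in>Arr Q S T.
    Comp Q S T U v u \<sqsubseteq>\<^bsub>Hom Q S U\<^esub> w \<longleftrightarrow> u \<sqsubseteq>\<^bsub>Hom Q S T\<^esub> rimp Q S T U v w)"
  unfolding rimp_def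
  by (rule theI', rule residual_ex1)
    (use assms in \<open>auto intro: hom_complete_lattice Comp_closed Comp_Sup_right\<close>)

end

record ('o, 'a, 'x) qcat =
  Objs :: "'x set"
  ext :: "'x \<Rightarrow> 'o"
  hm :: "'x \<Rightarrow> 'x \<Rightarrow> 'a"

locale qcategory = quantaloid Q
  for Q :: "('o, 'a) quantaloid" and E :: "('o, 'a, 'x) qcat" +
  assumes ext_closed: "X \<in> Objs E \<Longrightarrow> ext E X \<in> Ob Q"
    and hm_closed: "\<lbrakk>X \<in> Objs E; Y \<in> Objs E\<rbrakk> \<Longrightarrow> hm E X Y \<in> Arr Q (ext E X) (ext E Y)"
    and hm_Id: "X \<in> Objs E \<Longrightarrow> Id Q (ext E X) \<sqsubseteq>\<^bsub>Hom Q (ext E X) (ext E X)\<^esub> hm E X X"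
    and hm_Comp: "\<lbrakk>X \<in> Objs E; Y \<in> Objs E; Z \<in> Objs E\<rbrakk> \<Longrightarrow>
      Comp Q (ext E X) (ext E Y) (ext E Z) (hm E Y Z) (hm E X Y)
        \<sqsubseteq>\<^bsub>Hom Q (ext E X) (ext E Z)\<^esub> hm E X Z"

definition obj_le :: "('o, 'a) quantaloid \<Rightarrow> ('o, 'a, 'x) qcat \<Rightarrow> 'x \<Rightarrow> 'x \<Rightarrow> bool" where
  "obj_le Q E X Y \<longleftrightarrow>
     ext E X = ext E Y \<and> Id Q (ext E X) \<sqsubseteq>\<^bsub>Hom Q (ext E X) (ext E Y)\<^esub> hm E X Y"

definition obj_iso :: "('o, 'a) quantaloid \<Rightarrow> ('o, 'a, 'x) qcat \<Rightarrow> 'x \<Rightarrow> 'x \<Rightarrow> bool" where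
  "obj_iso Q E X Y \<longleftrightarrow> obj_le Q E X Y \<and> obj_le Q E Y X"

definition qfunctor ::
  "('o, 'a) quantaloid \<Rightarrow> ('o, 'a, 'x) qcat \<Rightarrow> ('o, 'a, 'y) qcat \<Rightarrow> ('x \<Rightarrow> 'y) \<Rightarrow> bool" where
  "qfunctor Q D E F \<longleftrightarrow>
     (\<forall>X\<in>Objs D. F X \<in> Objs E \<and> ext E (F X) = ext D X) \<and>
     (\<forall>X\<in>Objs D. \<forall>Y\<in>Objs D. hm D X Y \<sqsubseteq>\<^bsub>Hom Q (ext D X) (ext D Y)\<^esub> hm E (F X) (F Y))"

definition fun_le ::
  "('o, 'a) quantaloid \<Rightarrow> ('o, 'a, 'x) qcat \<Rightarrow> ('o, 'a, 'y) qcat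
    \<Rightarrow> ('x \<Rightarrow> 'y) \<Rightarrow> ('x \<Rightarrow> 'y) \<Rightarrow> bool" where
  "fun_le Q D E F G \<longleftrightarrow> (\<forall>X\<in>Objs D. obj_le Q E (F X) (G X))"

definition fun_iso ::
  "('o, 'a) quantaloid \<Rightarrow> ('o, 'a, 'x) qcat \<Rightarrow> ('o, 'a, 'y) qcat
    \<Rightarrow> ('x \<Rightarrow> 'y) \<Rightarrow> ('x \<Rightarrow> 'y) \<Rightarrow> bool" where
  "fun_iso Q D E F G \<longleftrightarrow> (\<forall>X\<in>Objs D. obj_iso Q E (F X) (G X))"

definition adjunction ::
  "('o, 'a) quantaloid \<Rightarrow> ('o, 'a, 'x) qcat \<Rightarrow> ('o, 'a, 'y) qcat
    \<Rightarrow> ('x \<Rightarrow> 'y) \<Rightarrow> ('y \<Rightarrow> 'x) \<Rightarrow> bool" where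
  "adjunction Q D E L R \<longleftrightarrow> qfunctor Q D E L \<and> qfunctor Q E D R \<and>
     fun_le Q D D id (R \<circ> L) \<and> fun_le Q E E (L \<circ> R) id"

definition left_adjoint ::
  "('o, 'a) quantaloid \<Rightarrow> ('o, 'a, 'x) qcat \<Rightarrow> ('o, 'a, 'y) qcat \<Rightarrow> ('x \<Rightarrow> 'y) \<Rightarrow> bool" where
  "left_adjoint Q D E L \<longleftrightarrow> (\<exists>R. adjunction Q D E L R)"

definition right_adjoint ::
  "('o, 'a) quantaloid \<Rightarrow> ('o, 'a, 'x) qcat \<Rightarrow> ('o, 'a, 'y) qcat \<Rightarrow> ('x \<Rightarrow> 'y) \<Rightarrow> bool" where
  "right_adjoint Q D E R \<longleftrightarrow> (\<exists>L. adjunction Q E D L R)"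

definition sink ::
  "('o, 'a) quantaloid \<Rightarrow> ('o, 'a, 'x) qcat \<Rightarrow> 'o \<Rightarrow> ('x \<Rightarrow> 'a) \<Rightarrow> bool" where
  "sink Q D T \<sigma> \<longleftrightarrow> (\<forall>X\<in>Objs D. \<sigma> X \<in> Arr Q (ext D X) T)"

definition source ::
  "('o, 'a) quantaloid \<Rightarrow> ('o, 'a, 'x) qcat \<Rightarrow> 'o \<Rightarrow> ('x \<Rightarrow> 'a) \<Rightarrow> bool" where
  "source Q D T \<tau> \<longleftrightarrow> (\<forall>X\<in>Objs D. \<tau> X \<in> Arr Q T (ext D X))"

definition is_colimit ::
  "('o, 'a) quantaloid \<Rightarrow> ('o, 'a, 'x) qcat \<Rightarrow> ('o, 'a, 'y) qcat
    \<Rightarrow> ('x \<Rightarrow> 'y) \<Rightarrow> ('x \<Rightarrow> 'a) \<Rightarrow> 'y \<Rightarrow> bool" where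
  "is_colimit Q D E F \<sigma> C \<longleftrightarrow> C \<in> Objs E \<and> sink Q D (ext E C) \<sigma> \<and>
     (\<forall>Y\<in>Objs E. hm E C Y =
        \<Sqinter>\<^bsub>Hom Q (ext E C) (ext E Y)\<^esub>
          ((\<lambda>X. limp Q (ext D X) (ext E C) (ext E Y) (hm E (F X) Y) (\<sigma> X)) ` Objs D))"

definition is_limit ::
  "('o, 'a) quantaloid \<Rightarrow> ('o, 'a, 'x) qcat \<Rightarrow> ('o, 'a, 'y) qcat
    \<Rightarrow> ('x \<Rightarrow> 'y) \<Rightarrow> ('x \<Rightarrow> 'a) \<Rightarrow> 'y \<Rightarrow> bool" where
  "is_limit Q D E F \<tau> C \<longleftrightarrow> C \<in> Objs E \<and> source Q D (ext E C) \<tau> \<and>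
     (\<forall>Y\<in>Objs E. hm E Y C =
        \<Sqinter>\<^bsub>Hom Q (ext E Y) (ext E C)\<^esub>
          ((\<lambda>X. rimp Q (ext E Y) (ext E C) (ext D X) (\<tau> X) (hm E Y (F X))) ` Objs D))"

definition dense_qfunctor ::
  "('o, 'a) quantaloid \<Rightarrow> ('o, 'a, 'x) qcat \<Rightarrow> ('o, 'a, 'y) qcat \<Rightarrow> ('x \<Rightarrow> 'y) \<Rightarrow> bool" where
  "dense_qfunctor Q D E F \<longleftrightarrow> qfunctor Q D E F \<and> (\<forall>C\<in>Objs E. \<exists>\<sigma>. is_colimit Q D E F \<sigma> C)"

definition codense_qfunctor ::
  "('o, 'a) quantaloid \<Rightarrow> ('o, 'a, 'x) qcat \<Rightarrow> ('o, 'a, 'y) qcat \<Rightarrow> ('x \<Rightarrow> 'y) \<Rightarrow> bool" where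
  "codense_qfunctor Q D E F \<longleftrightarrow> qfunctor Q D E F \<and> (\<forall>C\<in>Objs E. \<exists>\<tau>. is_limit Q D E F \<tau> C)"

definition full_sub :: "('o, 'a, 'x) qcat \<Rightarrow> 'x set \<Rightarrow> ('o, 'a, 'x) qcat" where
  "full_sub E A = E\<lparr>Objs := A\<rparr>"

definition Sierpinski :: "('o, 'a) quantaloid \<Rightarrow> ('o, 'a, 'x) qcat \<Rightarrow> 'x \<Rightarrow> bool" where
  "Sierpinski Q E X \<longleftrightarrow> X \<in> Objs E \<and> codense_qfunctor Q (full_sub E {X}) E id"

definition co_Sierpinski :: "('o, 'a) quantaloid \<Rightarrow> ('o, 'a, 'x) qcat \<Rightarrow> 'x \<Rightarrow> bool" where
  "co_Sierpinski Q E X \<longleftrightarrow> X \<in> Objs E \<and> dense_qfunctor Q (full_sub E {X}) E id"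

end

theory Submission
  imports Defs
begin

text \<open>
  A colimit is determined by its outgoing homs, and a left adjoint \<open>L \<stileturn> R\<close> rewrites these
  homs in \<open>E\<close> as homs in \<open>D\<close>. If \<open>C\<close> is the colimit of \<open>F\<close> weighted by \<open>\<sigma>\<close>, then
  \<open>E(LC,Y) = D(C,RY) = \<Sqinter>\<^sub>X D(FX,RY) \<swarrow> \<sigma>(X) = \<Sqinter>\<^sub>X E(LFX,Y) \<swarrow> \<sigma>(X)\<close>,
  so \<open>E(LC,-)\<close> depends on \<open>L\<close> only through the homs out of the objects \<open>LFX\<close>, which do not
  change when \<open>LFX\<close> is replaced by an isomorphic object. Hence \<open>LF \<cong> L'F\<close> gives
  \<open>E(LC,-) = E(L'C,-)\<close>, and the Yoneda argument (lemma \<open>obj_isoI_hm_eq\<close>) yields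
  \<open>LC \<cong> L'C\<close>. By density every object \<open>C\<close> of \<open>D\<close> is such a colimit.

  The codense half is the same statement over the opposite quantaloid: passing to opposites
  exchanges the two implications, limits with colimits and right adjoints with left adjoints,
  while isomorphism of objects is self-dual. The statements on Sierpinski and co-Sierpinski
  objects are the special case where \<open>F\<close> is the inclusion of a single object.
\<close>

section \<open>Order and composition in the hom-lattices\<close>

context quantaloid
begin

lemma hom_trans:
  assumes "S \<in> Ob Q" "T \<in> Ob Q"
    and "u \<in> Arr Q S T" "v \<in> Arr Q S T" "w \<in> Arr Q S T"
    and "u \<sqsubseteq>\<^bsub>Hom Q S T\<^esub> v" "v \<sqsubseteq>\<^bsub>Hom Q S T\<^esub> w"
  shows "u \<sqsubseteq>\<^bsub>Hom Q S T\<^esub> w"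
proof -
  interpret H: complete_lattice "Hom Q S T" using assms hom_complete_lattice by blast
  show ?thesis using assms H.le_trans by blast
qed

lemma hom_refl:
  assumes "S \<in> Ob Q" "T \<in> Ob Q" "u \<in> Arr Q S T"
  shows "u \<sqsubseteq>\<^bsub>Hom Q S T\<^esub> u"
proof -
  interpret H: complete_lattice "Hom Q S T" using assms hom_complete_lattice by blast
  show ?thesis using assms by simp
qed

lemma hom_antisym:
  assumes "S \<in> Ob Q" "T \<in> Ob Q" "u \<in> Arr Q S T" "v \<in> Arr Q S T"
    and "u \<sqsubseteq>\<^bsub>Hom Q S T\<^esub> v" "v \<sqsubseteq>\<^bsub>Hom Q S T\<^esub> u"
  shows "u = v"
proof -
  interpret H: complete_lattice "Hom Q S T" using assms hom_complete_lattice by blast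
  show ?thesis using assms H.le_antisym by blast
qed

text \<open>
  Composing with a fixed arrow has a residual, and the lower adjoint of a Galois connection
  is monotone.
\<close>

lemma Comp_mono_left:
  assumes "S \<in> Ob Q" "T \<in> Ob Q" "U \<in> Ob Q"
    and "u \<in> Arr Q S T" "v \<in> Arr Q T U" "v' \<in> Arr Q T U" "v \<sqsubseteq>\<^bsub>Hom Q T U\<^esub> v'"
  shows "Comp Q S T U v u \<sqsubseteq>\<^bsub>Hom Q S U\<^esub> Comp Q S T U v' u"
proof -
  have w: "Comp Q S T U v' u \<in> Arr Q S U" using assms Comp_closed by blast
  note iff = limp_iff[OF assms(1-4) w]
  have "v' \<sqsubseteq>\<^bsub>Hom Q T U\<^esub> limp Q S T U (Comp Q S T U v' u) u"
    using iff hom_refl[OF assms(1,3) w] assms(6) by blast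
  then show ?thesis using iff assms hom_trans by blast
qed

lemma Comp_mono_right:
  assumes "S \<in> Ob Q" "T \<in> Ob Q" "U \<in> Ob Q"
    and "v \<in> Arr Q T U" "u \<in> Arr Q S T" "u' \<in> Arr Q S T" "u \<sqsubseteq>\<^bsub>Hom Q S T\<^esub> u'"
  shows "Comp Q S T U v u \<sqsubseteq>\<^bsub>Hom Q S U\<^esub> Comp Q S T U v u'"
proof -
  have w: "Comp Q S T U v u' \<in> Arr Q S U" using assms Comp_closed by blast
  note iff = rimp_iff[OF assms(1-4) w]
  have "u' \<sqsubseteq>\<^bsub>Hom Q S T\<^esub> rimp Q S T U v (Comp Q S T U v u')"
    using iff hom_refl[OF assms(1,3) w] assms(6) by blast
  then show ?thesis using iff assms hom_trans by blast
qed

end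

section \<open>Homs and the order on objects\<close>

context qcategory
begin

text \<open>
  In both lemmas the composition law gives the bound once the unit is replaced by the larger
  arrow that witnesses the inequality of objects, as in
  \<open>E(X',Y) = E(X',Y) \<circ> 1 \<le> E(X',Y) \<circ> E(X,X') \<le> E(X,Y)\<close>.
\<close>

lemma hm_antimono_left:
  assumes X: "X \<in> Objs E" and X': "X' \<in> Objs E" and Y: "Y \<in> Objs E" and le: "obj_le Q E X X'"
  shows "hm E X' Y \<sqsubseteq>\<^bsub>Hom Q (ext E X) (ext E Y)\<^esub> hm E X Y"
proof -
  let ?S = "ext E X" and ?U = "ext E Y"
  have eq: "ext E X' = ?S" and Id_le: "Id Q ?S \<sqsubseteq>\<^bsub>Hom Q ?S ?S\<^esub> hm E X X'"
    using le by (auto simp: obj_le_def)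
  have S: "?S \<in> Ob Q" and U: "?U \<in> Ob Q" using X Y ext_closed by auto
  have a: "hm E X' Y \<in> Arr Q ?S ?U" "hm E X X' \<in> Arr Q ?S ?S" "hm E X Y \<in> Arr Q ?S ?U"
    using hm_closed[OF X' Y] hm_closed[OF X X'] hm_closed[OF X Y] eq by auto
  have "Comp Q ?S ?S ?U (hm E X' Y) (Id Q ?S) \<sqsubseteq>\<^bsub>Hom Q ?S ?U\<^esub>
      Comp Q ?S ?S ?U (hm E X' Y) (hm E X X')"
    using Comp_mono_right[OF S S U a(1) Id_closed[OF S] a(2) Id_le] .
  then show ?thesis
    using hm_Comp[OF X X' Y] hom_trans[OF S U a(1) Comp_closed[OF S S U a(2) a(1)] a(3)]
      Comp_Id_right[OF S U a(1)] eq by simp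
qed

lemma hm_mono_right:
  assumes X: "X \<in> Objs E" and Y: "Y \<in> Objs E" and Y': "Y' \<in> Objs E" and le: "obj_le Q E Y Y'"
  shows "hm E X Y \<sqsubseteq>\<^bsub>Hom Q (ext E X) (ext E Y)\<^esub> hm E X Y'"
proof -
  let ?S = "ext E X" and ?U = "ext E Y"
  have eq: "ext E Y' = ?U" and Id_le: "Id Q ?U \<sqsubseteq>\<^bsub>Hom Q ?U ?U\<^esub> hm E Y Y'"
    using le by (auto simp: obj_le_def)
  have S: "?S \<in> Ob Q" and U: "?U \<in> Ob Q" using X Y ext_closed by auto
  have a: "hm E X Y \<in> Arr Q ?S ?U" "hm E Y Y' \<in> Arr Q ?U ?U" "hm E X Y' \<in> Arr Q ?S ?U"
    using hm_closed[OF X Y] hm_closed[OF Y Y'] hm_closed[OF X Y'] eq by auto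
  have "Comp Q ?S ?U ?U (Id Q ?U) (hm E X Y) \<sqsubseteq>\<^bsub>Hom Q ?S ?U\<^esub>
      Comp Q ?S ?U ?U (hm E Y Y') (hm E X Y)"
    using Comp_mono_left[OF S U U a(1) Id_closed[OF U] a(2) Id_le] .
  then show ?thesis
    using hm_Comp[OF X Y Y'] hom_trans[OF S U a(1) Comp_closed[OF S U U a(1) a(2)] a(3)]
      Comp_Id_left[OF S U a(1)] eq by simp
qed

lemma hm_cong_left:
  assumes X: "X \<in> Objs E" and X': "X' \<in> Objs E" and Y: "Y \<in> Objs E" and iso: "obj_iso Q E X X'"
  shows "hm E X Y = hm E X' Y"
proof -
  have le: "obj_le Q E X X'" "obj_le Q E X' X" and eq: "ext E X' = ext E X"
    using iso unfolding obj_iso_def obj_le_def by blast+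
  have "hm E X' Y \<in> Arr Q (ext E X) (ext E Y)" using hm_closed[OF X' Y] eq by simp
  moreover have "hm E X Y \<sqsubseteq>\<^bsub>Hom Q (ext E X) (ext E Y)\<^esub> hm E X' Y"
    using hm_antimono_left[OF X' X Y le(2)] unfolding eq .
  ultimately show ?thesis
    using hom_antisym[OF ext_closed[OF X] ext_closed[OF Y] hm_closed[OF X Y]]
      hm_antimono_left[OF X X' Y le(1)] by blast
qed

text \<open>
  The Yoneda argument: the units \<open>1 \<le> E(X,X) = E(X',X)\<close> and \<open>1 \<le> E(X',X') = E(X,X')\<close>
  are the two inequalities between \<open>X\<close> and \<open>X'\<close>.
\<close>

lemma obj_isoI_hm_eq:
  assumes X: "X \<in> Objs E" and X': "X' \<in> Objs E" and eq: "ext E X = ext E X'"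
    and hm: "\<And>Y. Y \<in> Objs E \<Longrightarrow> hm E X Y = hm E X' Y"
  shows "obj_iso Q E X X'"
  unfolding obj_iso_def obj_le_def
  using hm_Id[OF X] hm_Id[OF X'] hm[OF X] hm[OF X'] eq by metis

end

section \<open>Left adjoints and dense functors\<close>

text \<open>
  From unit and counit to the bijection of homs:
  \<open>E(LX,Y) \<le> D(RLX,RY) \<le> D(X,RY)\<close> by functoriality of \<open>R\<close> and the unit, and
  \<open>D(X,RY) \<le> E(LX,LRY) \<le> E(LX,Y)\<close> by functoriality of \<open>L\<close> and the counit.
\<close>

lemma adjunction_hm:
  assumes QD: "qcategory Q D" and QE: "qcategory Q E" and adj: "adjunction Q D E L R"
    and X: "X \<in> Objs D" and Y: "Y \<in> Objs E"
  shows "hm E (L X) Y = hm D X (R Y)"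
proof -
  interpret D: qcategory Q D by (rule QD)
  interpret E: qcategory Q E by (rule QE)
  let ?S = "ext D X" and ?U = "ext E Y"
  have L: "qfunctor Q D E L" and R: "qfunctor Q E D R"
    and unit: "obj_le Q D X (R (L X))" and counit: "obj_le Q E (L (R Y)) Y"
    using adj X Y by (auto simp: adjunction_def fun_le_def)
  have LX: "L X \<in> Objs E" "ext E (L X) = ?S" and RY: "R Y \<in> Objs D" "ext D (R Y) = ?U"
    using L R X Y by (auto simp: qfunctor_def)
  have RLX: "R (L X) \<in> Objs D" "ext D (R (L X)) = ?S"
    and LRY: "L (R Y) \<in> Objs E" "ext E (L (R Y)) = ?U"
    using L R LX RY by (auto simp: qfunctor_def)
  have S: "?S \<in> Ob Q" and U: "?U \<in> Ob Q" using X Y D.ext_closed E.ext_closed by auto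
  have a: "hm E (L X) Y \<in> Arr Q ?S ?U" "hm D X (R Y) \<in> Arr Q ?S ?U"
    "hm D (R (L X)) (R Y) \<in> Arr Q ?S ?U" "hm E (L X) (L (R Y)) \<in> Arr Q ?S ?U"
    using E.hm_closed[OF LX(1) Y] D.hm_closed[OF X RY(1)] D.hm_closed[OF RLX(1) RY(1)]
      E.hm_closed[OF LX(1) LRY(1)] LX RY RLX LRY by auto
  have "hm E (L X) Y \<sqsubseteq>\<^bsub>Hom Q ?S ?U\<^esub> hm D (R (L X)) (R Y)"
    using R LX Y unfolding qfunctor_def by metis
  moreover have "hm D (R (L X)) (R Y) \<sqsubseteq>\<^bsub>Hom Q ?S ?U\<^esub> hm D X (R Y)"
    using D.hm_antimono_left[OF X RLX(1) RY(1) unit] RY by simp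
  ultimately have 1: "hm E (L X) Y \<sqsubseteq>\<^bsub>Hom Q ?S ?U\<^esub> hm D X (R Y)"
    using D.hom_trans[OF S U a(1) a(3) a(2)] by blast
  have "hm D X (R Y) \<sqsubseteq>\<^bsub>Hom Q ?S ?U\<^esub> hm E (L X) (L (R Y))"
    using L RY X unfolding qfunctor_def by metis
  moreover have "hm E (L X) (L (R Y)) \<sqsubseteq>\<^bsub>Hom Q ?S ?U\<^esub> hm E (L X) Y"
    using E.hm_mono_right[OF LX(1) LRY(1) Y counit] LX LRY by simp
  ultimately have 2: "hm D X (R Y) \<sqsubseteq>\<^bsub>Hom Q ?S ?U\<^esub> hm E (L X) Y"
    using D.hom_trans[OF S U a(2) a(4) a(1)] by blast
  show ?thesis using D.hom_antisym[OF S U a(1) a(2) 1 2] .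
qed

text \<open>
  The bijection of homs rewrites both the hom out of \<open>A\<close> and every hom out of \<open>F X\<close> in the
  defining formula of the colimit; the weight stays the same.
\<close>

lemma left_adjoint_preserves_colimit:
  assumes QD: "qcategory Q D" and QE: "qcategory Q E" and L: "left_adjoint Q D E L"
    and F: "qfunctor Q C D F" and colim: "is_colimit Q C D F \<sigma> A"
  shows "is_colimit Q C E (L \<circ> F) \<sigma> (L A)"
proof -
  obtain R where adj: "adjunction Q D E L R" using L by (auto simp: left_adjoint_def)
  have A: "A \<in> Objs D" using colim by (simp add: is_colimit_def)
  have LA: "L A \<in> Objs E" "ext E (L A) = ext D A"
    using adj A by (auto simp: adjunction_def qfunctor_def)
  have "hm E (L A) Y = \<Sqinter>\<^bsub>Hom Q (ext D A) (ext E Y)\<^esub>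
      ((\<lambda>X. limp Q (ext C X) (ext D A) (ext E Y) (hm E ((L \<circ> F) X) Y) (\<sigma> X)) ` Objs C)"
    if Y: "Y \<in> Objs E" for Y
  proof -
    have RY: "R Y \<in> Objs D" "ext D (R Y) = ext E Y"
      using adj Y by (auto simp: adjunction_def qfunctor_def)
    have FX: "hm D (F X) (R Y) = hm E ((L \<circ> F) X) Y" if "X \<in> Objs C" for X
      using adjunction_hm[OF QD QE adj _ Y, of "F X"] F that by (simp add: qfunctor_def)
    have "hm E (L A) Y = hm D A (R Y)" using adjunction_hm[OF QD QE adj A Y] .
    also have "\<dots> = \<Sqinter>\<^bsub>Hom Q (ext D A) (ext E Y)\<^esub>
      ((\<lambda>X. limp Q (ext C X) (ext D A) (ext E Y) (hm D (F X) (R Y)) (\<sigma> X)) ` Objs C)"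
      using colim RY by (simp add: is_colimit_def)
    finally show ?thesis using FX by (simp cong: image_cong)
  qed
  then show ?thesis using colim LA by (simp add: is_colimit_def)
qed

text \<open>
  A single weight \<open>\<sigma>\<close> presents both \<open>L A\<close> and \<open>L' A\<close> as colimits, of \<open>L \<circ> F\<close> and of
  \<open>L' \<circ> F\<close>. The colimit formula sees these two functors only through the homs out of their
  values, and isomorphic objects have equal homs.
\<close>

lemma left_adjoints_iso_if_iso_on_dense:
  assumes QD: "qcategory Q D" and QE: "qcategory Q E" and dense: "dense_qfunctor Q C D F"
    and L: "left_adjoint Q D E L" and L': "left_adjoint Q D E L'"
    and iso: "fun_iso Q C E (L \<circ> F) (L' \<circ> F)"
  shows "fun_iso Q D E L L'"
  unfolding fun_iso_def
proof
  fix A assume A: "A \<in> Objs D"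
  interpret E: qcategory Q E by (rule QE)
  have F: "qfunctor Q C D F" using dense by (simp add: dense_qfunctor_def)
  have obj: "L B \<in> Objs E" "L' B \<in> Objs E" "ext E (L B) = ext D B" "ext E (L' B) = ext D B"
    if "B \<in> Objs D" for B
    using L L' that by (auto simp: left_adjoint_def adjunction_def qfunctor_def)
  obtain \<sigma> where "is_colimit Q C D F \<sigma> A" using dense A by (auto simp: dense_qfunctor_def)
  then have colim: "is_colimit Q C E (L \<circ> F) \<sigma> (L A)" "is_colimit Q C E (L' \<circ> F) \<sigma> (L' A)"
    using left_adjoint_preserves_colimit[OF QD QE _ F] L L' by blast+
  show "obj_iso Q E (L A) (L' A)"
  proof (rule E.obj_isoI_hm_eq)
    fix Y assume Y: "Y \<in> Objs E"
    have "hm E ((L \<circ> F) X) Y = hm E ((L' \<circ> F) X) Y" if "X \<in> Objs C" for X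
      using E.hm_cong_left[OF _ _ Y] iso obj F that by (auto simp: fun_iso_def qfunctor_def)
    then show "hm E (L A) Y = hm E (L' A) Y"
      using colim Y obj[OF A] unfolding is_colimit_def by (simp cong: image_cong)
  qed (use obj[OF A] in auto)
qed

section \<open>Duality\<close>

definition op_quantaloid :: "('o, 'a) quantaloid \<Rightarrow> ('o, 'a) quantaloid" where
  "op_quantaloid Q = \<lparr>Ob = Ob Q, Hom = (\<lambda>S T. Hom Q T S), Id = Id Q,
     Comp = (\<lambda>S T U v u. Comp Q U T S u v)\<rparr>"

definition op_qcat :: "('o, 'a, 'x) qcat \<Rightarrow> ('o, 'a, 'x) qcat" where
  "op_qcat E = \<lparr>Objs = Objs E, ext = ext E, hm = (\<lambda>X Y. hm E Y X)\<rparr>"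

lemma op_quantaloid_simps [simp]:
  "Ob (op_quantaloid Q) = Ob Q" "Hom (op_quantaloid Q) S T = Hom Q T S"
  "Id (op_quantaloid Q) = Id Q" "Comp (op_quantaloid Q) S T U v u = Comp Q U T S u v"
  by (simp_all add: op_quantaloid_def)

lemma op_qcat_simps [simp]:
  "Objs (op_qcat E) = Objs E" "ext (op_qcat E) = ext E" "hm (op_qcat E) X Y = hm E Y X"
  by (simp_all add: op_qcat_def)

lemma quantaloid_op:
  assumes "quantaloid Q"
  shows "quantaloid (op_quantaloid Q)"
proof -
  interpret quantaloid Q by (rule assms)
  show ?thesis
    by (rule quantaloid.intro)
      (simp_all add: hom_complete_lattice Id_closed Comp_closed Comp_assoc Comp_Id_left
        Comp_Id_right Comp_Sup_left Comp_Sup_right)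
qed

lemma qcategory_op:
  assumes "qcategory Q E"
  shows "qcategory (op_quantaloid Q) (op_qcat E)"
proof -
  interpret qcategory Q E by (rule assms)
  interpret op: quantaloid "op_quantaloid Q" by (rule quantaloid_op) unfold_locales
  show ?thesis by unfold_locales (simp_all add: ext_closed hm_closed hm_Id hm_Comp)
qed

lemma obj_le_op: "obj_le (op_quantaloid Q) (op_qcat E) X Y \<longleftrightarrow> obj_le Q E Y X"
  by (auto simp: obj_le_def)

lemma fun_iso_op:
  "fun_iso (op_quantaloid Q) (op_qcat D) (op_qcat E) F G \<longleftrightarrow> fun_iso Q D E F G"
  by (auto simp: fun_iso_def obj_iso_def obj_le_op)

lemma qfunctor_op:
  "qfunctor (op_quantaloid Q) (op_qcat D) (op_qcat E) F \<longleftrightarrow> qfunctor Q D E F"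
  by (auto simp: qfunctor_def)

text \<open>
  The inequalities \<open>1 \<le> RL\<close> and \<open>LR \<le> 1\<close> are reversed by taking opposites, so unit and
  counit swap their roles and the two adjoints swap sides.
\<close>

lemma left_adjoint_op:
  "left_adjoint (op_quantaloid Q) (op_qcat D) (op_qcat E) R \<longleftrightarrow> right_adjoint Q D E R"
  by (auto simp: left_adjoint_def right_adjoint_def adjunction_def fun_le_def qfunctor_op
      obj_le_op)

text \<open>
  An extension along \<open>u\<close> is a lifting through \<open>u\<close> once arrows are reversed; this is what turns
  the formula for colimits into the one for limits.
\<close>

lemma limp_op: "limp (op_quantaloid Q) S T U w u = rimp Q U T S u w"
  by (simp add: limp_def rimp_def)

lemma dense_qfunctor_op:
  "dense_qfunctor (op_quantaloid Q) (op_qcat D) (op_qcat E) F \<longleftrightarrow> codense_qfunctor Q D E F"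
  by (simp add: dense_qfunctor_def codense_qfunctor_def qfunctor_op is_colimit_def is_limit_def
      sink_def source_def limp_op)

lemma right_adjoints_iso_if_iso_on_codense:
  assumes "qcategory Q D" and "qcategory Q E" and "codense_qfunctor Q C D F"
    and "right_adjoint Q D E R" and "right_adjoint Q D E R'"
    and "fun_iso Q C E (R \<circ> F) (R' \<circ> F)"
  shows "fun_iso Q D E R R'"
  using left_adjoints_iso_if_iso_on_dense[of "op_quantaloid Q" "op_qcat D" "op_qcat E"
      "op_qcat C" F R R'] assms
  by (simp add: qcategory_op dense_qfunctor_op left_adjoint_op fun_iso_op)

section \<open>Rigidity of adjoints along dense and codense functors\<close>

lemma fun_iso_full_sub_singleton:
  "fun_iso Q (full_sub D {X}) E (G \<circ> id) (H \<circ> id) \<longleftrightarrow> obj_iso Q E (G X) (H X)"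
  by (simp add: fun_iso_def full_sub_def)

theorem proposition6p1:
  fixes Q :: "('o, 'a) quantaloid"
    and D :: "('o, 'a, 'd) qcat"
    and E :: "('o, 'a, 'e) qcat"
  assumes "quantaloid Q" and "qcategory Q D" and "qcategory Q E"
  shows "(\<forall>(C :: ('o, 'a, 'c) qcat) F L L'.
            qcategory Q C \<longrightarrow> dense_qfunctor Q C D F \<longrightarrow>
            left_adjoint Q D E L \<longrightarrow> left_adjoint Q D E L' \<longrightarrow>
            fun_iso Q C E (L \<circ> F) (L' \<circ> F) \<longrightarrow> fun_iso Q D E L L')
       \<and> (\<forall>(C :: ('o, 'a, 'c) qcat) F R R'.
            qcategory Q C \<longrightarrow> codense_qfunctor Q C D F \<longrightarrow>
            right_adjoint Q D E R \<longrightarrow> right_adjoint Q D E R' \<longrightarrow>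
            fun_iso Q C E (R \<circ> F) (R' \<circ> F) \<longrightarrow> fun_iso Q D E R R')
       \<and> (\<forall>X L L'. co_Sierpinski Q D X \<longrightarrow>
            left_adjoint Q D E L \<longrightarrow> left_adjoint Q D E L' \<longrightarrow>
            obj_iso Q E (L X) (L' X) \<longrightarrow> fun_iso Q D E L L')
       \<and> (\<forall>X R R'. Sierpinski Q D X \<longrightarrow>
            right_adjoint Q D E R \<longrightarrow> right_adjoint Q D E R' \<longrightarrow>
            obj_iso Q E (R X) (R' X) \<longrightarrow> fun_iso Q D E R R')"
proof (intro conjI allI impI)
  fix C :: "('o, 'a, 'c) qcat" and F L L'
  assume "dense_qfunctor Q C D F" "left_adjoint Q D E L" "left_adjoint Q D E L'"
    "fun_iso Q C E (L \<circ> F) (L' \<circ> F)"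
  then show "fun_iso Q D E L L'"
    using left_adjoints_iso_if_iso_on_dense[OF assms(2,3)] by blast
next
  fix C :: "('o, 'a, 'c) qcat" and F R R'
  assume "codense_qfunctor Q C D F" "right_adjoint Q D E R" "right_adjoint Q D E R'"
    "fun_iso Q C E (R \<circ> F) (R' \<circ> F)"
  then show "fun_iso Q D E R R'"
    using right_adjoints_iso_if_iso_on_codense[OF assms(2,3)] by blast
next
  fix X L L'
  assume "co_Sierpinski Q D X" "left_adjoint Q D E L" "left_adjoint Q D E L'"
    "obj_iso Q E (L X) (L' X)"
  then show "fun_iso Q D E L L'"
    using left_adjoints_iso_if_iso_on_dense[OF assms(2,3)]
    by (metis co_Sierpinski_def fun_iso_full_sub_singleton)
next
  fix X R R'
  assume "Sierpinski Q D X" "right_adjoint Q D E R" "right_adjoint Q D E R'"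
    "obj_iso Q E (R X) (R' X)"
  then show "fun_iso Q D E R R'"
    using right_adjoints_iso_if_iso_on_codense[OF assms(2,3)]
    by (metis Sierpinski_def fun_iso_full_sub_singleton)
qed

end
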